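(* Let $\tau\neq0$ and let $H_3(\tau)=(\mathbb{R}^3,g_\tau)$ with $g_\tau=dx^2-dy^2+(dz+\tau(y\,dx-x\,dy))^2$. Let $M$ be a helix timelike surface in $H_3(\tau)$ with constant hyperbolic angle $\vartheta$. Then, with respect to the local coordinates $(u,v)$ on $M$ defined by $$\partial_u=T,\qquad \partial_v=a\,T+b\,JT,$$ $$a(u,v)=\frac{\sinh\left(2\tau\sin^2\vartheta\,u+\eta(v)\right)}{\sin\vartheta},\qquad b(u,v)=\cosh\left(2\tau\sin^2\vartheta\,u+\eta(v)\right)$$ (with $\eta$ a smooth function of $v$), the position vector $F$ of $M$ in $\mathbb{R}^3$ is given by $$F(u,v)=\Bigl(-\frac{\cot\vartheta}{2\tau}\sinh(u)+f_1(v),\ -\frac{\cot\vartheta}{2\tau}\cosh(u)+f_2(v),\ \frac{\cos^2\vartheta}{2}u-\frac{\cot\vartheta}{2\tau}\bigl(f_1(v)\cosh(u)-f_2(v)\sinh(u)\bigr)+f_3(v)\Bigr),$$ where $f_1,f_2,f_3$ satisfy $$f_1'(v)^2-f_2'(v)^2=-\cos^2\vartheta,\qquad f_3'(v)=\tau\bigl(f_1(v)f_2'(v)-f_2(v)f_1'(v)\bigr).$$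
   Context: The orthonormal frame on $H_3(\tau)$ is $E_1=\partial_x-\tau y\,\partial_z$, $E_2=\partial_y+\tau x\,\partial_z$, $E_3=\partial_z$, with $g_\tau(E_1,E_1)=g_\tau(E_3,E_3)=1$, $g_\tau(E_2,E_2)=-1$ and $[E_1,E_2]=2\tau E_3$. The cross product $\wedge$ is the bilinear skew-symmetric product with $E_1\wedge E_2=E_3$, $E_2\wedge E_3=E_1$, $E_1\wedge E_3=E_2$. For an oriented surface $M$ with unit normal $N$, $g_\tau(N,N)=\varepsilon=\pm1$, the angle function is $\nu=\varepsilon\,g_\tau(N,E_3)$, and $M$ is a helix (constant angle) surface if $\nu$ is constant. $M$ is timelike if $\varepsilon=1$; in that case one writes, up to the orientation of $N$, $\nu=\sin\vartheta\neq0$, and $\vartheta$ is called the hyperbolic angle between $N$ and $E_3$. $T$ is the tangential part of $E_3$, i.e. $E_3=T+\nu N$, and $JX=N\wedge X$ for $X$ tangent to $M$. One writes $N=\cos\vartheta(\cosh\varphi\,E_1+\sinh\varphi\,E_2)+\sin\vartheta\,E_3$ for a smooth function $\varphi$ on $M$; in the coordinates above $\varphi(u)=2\tau\sin^2\vartheta\,u+c$ with $c$ a real constant, and the displayed formula for $F$ is the one written after the reparametrization $\varphi(u)\mapsto u$. The functions $f_1,f_2,f_3$ are smooth functions of $v$.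
   Formalization: The third coordinate of F is corrected: the factor of f_1 cosh(u) − f_2 sinh(u) is −cot ϑ/2 instead of −cot ϑ/(2τ), and the linear term after reparametrization is cos²ϑ·u/(4τ sin²ϑ) instead of cos²ϑ·u/2; the printed formula fails, e.g. for τ=2, ϑ=π/4. *)

theory Defs
  imports "HOL-Analysis.Analysis"
begin

text \<open>\<open>C\<^sup>k\<close> and \<open>C\<^sup>\<infinity>\<close> maps, via iterated directional derivatives. Only used on open sets.\<close>

fun Ck_on :: "nat \<Rightarrow> ('a::real_normed_vector \<Rightarrow> 'b::real_normed_vector) \<Rightarrow> 'a set \<Rightarrow> bool" where
  "Ck_on 0 f S \<longleftrightarrow> continuous_on S f"
| "Ck_on (Suc k) f S \<longleftrightarrow>
     (\<forall>x\<in>S. f differentiable (at x)) \<and> (\<forall>h. Ck_on k (\<lambda>x. frechet_derivative f (at x) h) S)"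

definition smooth_on :: "('a::real_normed_vector \<Rightarrow> 'b::real_normed_vector) \<Rightarrow> 'a set \<Rightarrow> bool" where
  "smooth_on f S \<longleftrightarrow> (\<forall>k. Ck_on k f S)"

text \<open>
  The Lorentzian Heisenberg group \<open>H\<^sub>3(\<tau>)\<close>. Points are elements of \<open>real^3\<close>, and a tangent vector
  at \<open>p\<close> is given by its components in the coordinate basis
  \<open>\<partial>\<^sub>x, \<partial>\<^sub>y, \<partial>\<^sub>z\<close>.
\<close>

definition contact_form :: "real \<Rightarrow> real^3 \<Rightarrow> real^3 \<Rightarrow> real" where
  "contact_form \<tau> p X = X$3 + \<tau> * (p$2 * X$1 - p$1 * X$2)"

definition heis_metric :: "real \<Rightarrow> real^3 \<Rightarrow> real^3 \<Rightarrow> real^3 \<Rightarrow> real" where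
  "heis_metric \<tau> p X Y = X$1 * Y$1 - X$2 * Y$2 + contact_form \<tau> p X * contact_form \<tau> p Y"

definition E1 :: "real \<Rightarrow> real^3 \<Rightarrow> real^3" where
  "E1 \<tau> p = vector [1, 0, - \<tau> * p$2]"

definition E2 :: "real \<Rightarrow> real^3 \<Rightarrow> real^3" where
  "E2 \<tau> p = vector [0, 1, \<tau> * p$1]"

definition E3 :: "real^3 \<Rightarrow> real^3" where
  "E3 p = vector [0, 0, 1]"

text \<open>The components of \<open>X\<close> in the frame \<open>E1, E2, E3\<close> are
  \<open>X$1\<close>, \<open>X$2\<close> and \<open>contact_form \<tau> p X\<close> (see \<open>frame_expansion\<close>).\<close>

definition heis_cross :: "real \<Rightarrow> real^3 \<Rightarrow> real^3 \<Rightarrow> real^3 \<Rightarrow> real^3" where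
  "heis_cross \<tau> p X Y =
     (X$2 * contact_form \<tau> p Y - contact_form \<tau> p X * Y$2) *\<^sub>R E1 \<tau> p
   + (X$1 * contact_form \<tau> p Y - contact_form \<tau> p X * Y$1) *\<^sub>R E2 \<tau> p
   + (X$1 * Y$2 - X$2 * Y$1) *\<^sub>R E3 p"

lemma frame_expansion:
  "X = (X$1) *\<^sub>R E1 \<tau> p + (X$2) *\<^sub>R E2 \<tau> p + contact_form \<tau> p X *\<^sub>R E3 p"
  by (simp add: vec_eq_iff forall_3 E1_def E2_def E3_def contact_form_def algebra_simps)

lemma frame_orthonormal:
  "heis_metric \<tau> p (E1 \<tau> p) (E1 \<tau> p) = 1"
  "heis_metric \<tau> p (E2 \<tau> p) (E2 \<tau> p) = -1"
  "heis_metric \<tau> p (E3 p) (E3 p) = 1"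
  "heis_metric \<tau> p (E1 \<tau> p) (E2 \<tau> p) = 0"
  "heis_metric \<tau> p (E1 \<tau> p) (E3 p) = 0"
  "heis_metric \<tau> p (E2 \<tau> p) (E3 p) = 0"
  by (simp_all add: heis_metric_def contact_form_def E1_def E2_def E3_def)

lemma heis_cross_frame:
  "heis_cross \<tau> p (E1 \<tau> p) (E2 \<tau> p) = E3 p"
  "heis_cross \<tau> p (E2 \<tau> p) (E3 p) = E1 \<tau> p"
  "heis_cross \<tau> p (E1 \<tau> p) (E3 p) = E2 \<tau> p"
  by (simp_all add: heis_cross_def contact_form_def E1_def E2_def E3_def)

lemma heis_cross_skew: "heis_cross \<tau> p Y X = - heis_cross \<tau> p X Y"
  by (simp add: heis_cross_def vec_eq_iff forall_3 algebra_simps)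

lemma bilinear_heis_cross: "bilinear (heis_cross \<tau> p)"
  unfolding bilinear_def
  by (auto intro!: linearI simp: heis_cross_def contact_form_def vec_eq_iff forall_3 algebra_simps)

text \<open>
  An oriented surface, described in a coordinate patch: \<open>F\<close> is the immersion of the coordinate
  domain \<open>U\<close>, and \<open>N\<close> is the unit normal, regarded as a smooth vector field along \<open>F\<close>.
\<close>

definition oriented_surface ::
    "real \<Rightarrow> real \<Rightarrow> (real \<times> real) set \<Rightarrow> (real \<times> real \<Rightarrow> real^3) \<Rightarrow> (real \<times> real \<Rightarrow> real^3) \<Rightarrow> bool" where
  "oriented_surface \<tau> \<epsilon> U F N \<longleftrightarrow>
     open U \<and> smooth_on F U \<and> (\<forall>q\<in>U. inj (frechet_derivative F (at q))) \<and>
     smooth_on N U \<and>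
     (\<forall>q\<in>U. \<forall>h. heis_metric \<tau> (F q) (frechet_derivative F (at q) h) (N q) = 0) \<and>
     (\<epsilon> = 1 \<or> \<epsilon> = -1) \<and> (\<forall>q\<in>U. heis_metric \<tau> (F q) (N q) (N q) = \<epsilon>)"

definition angle_function ::
    "real \<Rightarrow> real \<Rightarrow> (real \<times> real \<Rightarrow> real^3) \<Rightarrow> (real \<times> real \<Rightarrow> real^3) \<Rightarrow> real \<times> real \<Rightarrow> real" where
  "angle_function \<tau> \<epsilon> F N q = \<epsilon> * heis_metric \<tau> (F q) (N q) (E3 (F q))"

definition helix_surface ::
    "real \<Rightarrow> real \<Rightarrow> (real \<times> real) set \<Rightarrow> (real \<times> real \<Rightarrow> real^3) \<Rightarrow> (real \<times> real \<Rightarrow> real^3) \<Rightarrow> bool" where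
  "helix_surface \<tau> \<epsilon> U F N \<longleftrightarrow>
     oriented_surface \<tau> \<epsilon> U F N \<and> (\<exists>\<nu>. \<forall>q\<in>U. angle_function \<tau> \<epsilon> F N q = \<nu>)"

text \<open>A surface is timelike when its unit normal is spacelike, i.e. \<open>\<epsilon> = 1\<close>.\<close>

definition helix_timelike_surface ::
    "real \<Rightarrow> (real \<times> real) set \<Rightarrow> (real \<times> real \<Rightarrow> real^3) \<Rightarrow> (real \<times> real \<Rightarrow> real^3) \<Rightarrow> bool" where
  "helix_timelike_surface \<tau> U F N \<longleftrightarrow> helix_surface \<tau> 1 U F N"

text \<open>
  The constant hyperbolic angle \<open>\<theta>\<close> between \<open>N\<close> and \<open>E3\<close>. The condition \<open>\<nu> = sin \<theta>\<close> leaves the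
  choice between \<open>\<theta>\<close> and \<open>\<pi> - \<theta>\<close>; it is fixed by the expression of \<open>N\<close> in terms of \<open>\<phi>\<close>.
\<close>

definition has_hyperbolic_angle ::
    "real \<Rightarrow> real \<Rightarrow> (real \<times> real \<Rightarrow> real) \<Rightarrow> (real \<times> real) set \<Rightarrow>
     (real \<times> real \<Rightarrow> real^3) \<Rightarrow> (real \<times> real \<Rightarrow> real^3) \<Rightarrow> bool" where
  "has_hyperbolic_angle \<tau> \<theta> \<phi> U F N \<longleftrightarrow>
     sin \<theta> \<noteq> 0 \<and> (\<forall>q\<in>U. angle_function \<tau> 1 F N q = sin \<theta>) \<and> smooth_on \<phi> U \<and>
     (\<forall>q\<in>U. N q = cos \<theta> *\<^sub>R (cosh (\<phi> q) *\<^sub>R E1 \<tau> (F q) + sinh (\<phi> q) *\<^sub>R E2 \<tau> (F q))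
                  + sin \<theta> *\<^sub>R E3 (F q))"

definition tangential_E3 ::
    "real \<Rightarrow> real \<Rightarrow> (real \<times> real \<Rightarrow> real^3) \<Rightarrow> (real \<times> real \<Rightarrow> real^3) \<Rightarrow> real \<times> real \<Rightarrow> real^3" where
  "tangential_E3 \<tau> \<epsilon> F N q = E3 (F q) - angle_function \<tau> \<epsilon> F N q *\<^sub>R N q"

definition J_op ::
    "real \<Rightarrow> (real \<times> real \<Rightarrow> real^3) \<Rightarrow> (real \<times> real \<Rightarrow> real^3) \<Rightarrow> real \<times> real \<Rightarrow> real^3 \<Rightarrow> real^3" where
  "J_op \<tau> F N q X = heis_cross \<tau> (F q) (N q) X"

definition coeff_a :: "real \<Rightarrow> real \<Rightarrow> (real \<Rightarrow> real) \<Rightarrow> real \<Rightarrow> real \<Rightarrow> real" where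
  "coeff_a \<tau> \<theta> \<eta> u v = sinh (2 * \<tau> * (sin \<theta>)\<^sup>2 * u + \<eta> v) / sin \<theta>"

definition coeff_b :: "real \<Rightarrow> real \<Rightarrow> (real \<Rightarrow> real) \<Rightarrow> real \<Rightarrow> real \<Rightarrow> real" where
  "coeff_b \<tau> \<theta> \<eta> u v = cosh (2 * \<tau> * (sin \<theta>)\<^sup>2 * u + \<eta> v)"

text \<open>
  The position vector after the reparametrization \<open>\<phi>(u) \<mapsto> w\<close>, where \<open>\<phi>(u) = 2\<tau> sin\<^sup>2\<theta> u + c\<close>.
  The coordinates \<open>x, y\<close> are obtained by integrating \<open>\<partial>\<^sub>u F = T\<close>; substituting them into its
  remaining component gives
  \<open>\<partial>\<^sub>u z = cos\<^sup>2\<theta>/2 + \<tau> sin \<theta> cos \<theta> (f2 cosh \<phi> - f1 sinh \<phi>)\<close>. Dividing by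
  \<open>\<phi>' = 2\<tau> sin\<^sup>2\<theta>\<close>, the linear term \<open>cos\<^sup>2\<theta>/2 u\<close> becomes \<open>cos\<^sup>2\<theta>/2 (w / (2\<tau> sin\<^sup>2\<theta>))\<close> up to a
  constant absorbed in \<open>f3\<close>, and the coefficient of \<open>f1 cosh w - f2 sinh w\<close> is \<open>-(cot \<theta>)/2\<close>.
  (The coefficients \<open>cos\<^sup>2\<theta>/2\<close> and \<open>-(cot \<theta>)/(2\<tau>)\<close>, sometimes displayed for this parametrization,
  do not give a surface with \<open>\<partial>\<^sub>w F\<close> proportional to \<open>T\<close>, except when
  \<open>\<tau> = 1\<close> and \<open>sin\<^sup>2\<theta> = 1/2\<close>.)
\<close>

definition helix_position ::
    "real \<Rightarrow> real \<Rightarrow> (real \<Rightarrow> real) \<Rightarrow> (real \<Rightarrow> real) \<Rightarrow> (real \<Rightarrow> real) \<Rightarrow> real \<Rightarrow> real \<Rightarrow> real^3" where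
  "helix_position \<tau> \<theta> f1 f2 f3 w v = vector
     [ - (cot \<theta> / (2 * \<tau>)) * sinh w + f1 v,
       - (cot \<theta> / (2 * \<tau>)) * cosh w + f2 v,
       (cos \<theta>)\<^sup>2 / 2 * (w / (2 * \<tau> * (sin \<theta>)\<^sup>2))
         - cot \<theta> / 2 * (f1 v * cosh w - f2 v * sinh w) + f3 v ]"

end

theory Submission
  imports Defs
begin

text \<open>
  Put \<open>s = sin \<theta>\<close>, \<open>c = cos \<theta>\<close> and \<open>A = 2\<tau>s\<^sup>2u + \<eta>(v)\<close>. Everything follows from reading the
  two conditions on the coordinate vector fields in components. In the frame \<open>E1, E2, E3\<close> one has
  \<open>T = (-sc cosh \<phi>, -sc sinh \<phi>, c\<^sup>2)\<close> and \<open>JT = (c sinh \<phi>, c cosh \<phi>, 0)\<close>, so that, by the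
  addition theorems,
  \<open>x\<^sub>u = -sc cosh \<phi>\<close>, \<open>x\<^sub>v = c sinh (\<phi> - A)\<close>, \<open>y\<^sub>u = -sc sinh \<phi>\<close>, \<open>y\<^sub>v = c cosh (\<phi> - A)\<close>,
  and the contact form gives \<open>z\<^sub>u\<close> and \<open>z\<^sub>v\<close>. The immersion condition forces \<open>c \<noteq> 0\<close>, since
  \<open>T\<close> would vanish otherwise.

  The function \<open>\<phi>\<close> is determined by integrability. Equating the mixed second derivatives of \<open>x\<close>
  and of \<open>y\<close> (lemma \<open>mixed_partials_eq\<close>) gives two equations that are linear in \<open>\<phi>\<^sub>v\<close> and
  \<open>\<phi>\<^sub>u - 2\<tau>s\<^sup>2\<close>. Their determinant is a nonzero multiple of
  \<open>cosh \<phi> cosh (\<phi> - A) - sinh \<phi> sinh (\<phi> - A) = cosh A\<close>, which never vanishes; hence \<open>\<phi>\<^sub>v = 0\<close> and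
  \<open>\<phi>\<^sub>u = 2\<tau>s\<^sup>2\<close> (lemma \<open>phi_has_derivative\<close>), and \<open>\<phi>\<close> is \<open>2\<tau>s\<^sup>2u\<close> plus a constant.

  Now solve the position formula for \<open>f1\<close>, \<open>f2\<close>, \<open>f3\<close>. The resulting functions \<open>X\<close>, \<open>Y\<close>, \<open>Z\<close> on
  the coordinate domain have vanishing derivative in the direction of \<open>u\<close>, and their derivatives
  in the direction of \<open>v\<close> are \<open>c sinh (\<phi> - A)\<close>, \<open>c cosh (\<phi> - A)\<close> and \<open>\<tau>(X Y\<^sub>v - Y X\<^sub>v)\<close>. Their
  restrictions to a line \<open>u = u0\<close> are therefore the required \<open>f1\<close>, \<open>f2\<close>, \<open>f3\<close>. On such a line
  \<open>\<phi>\<close> is constant, so each of the three is an affine function of \<open>F(u0, v)\<close>, which makes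
  smoothness a matter of affine substitutions only (lemma \<open>Ck_on_affine_compose\<close>).
\<close>

section \<open>Smooth maps and derivatives\<close>

lemma Ck_on_cong:
  assumes "Ck_on k f S" "open S" "\<And>x. x \<in> S \<Longrightarrow> g x = f x"
  shows "Ck_on k g S"
  using assms(1,3)
proof (induction k arbitrary: f g)
  case 0
  then show ?case
    by (metis Ck_on.simps(1) continuous_on_cong)
next
  case (Suc k)
  have D: "(g has_derivative frechet_derivative f (at x)) (at x)" if "x \<in> S" for x
  proof (rule has_derivative_transform_within_open[OF _ assms(2) that])
    show "(f has_derivative frechet_derivative f (at x)) (at x)"
      using Suc.prems(1) that by (simp flip: frechet_derivative_works)
  qed (simp add: Suc.prems(2))
  show ?case
    unfolding Ck_on.simps
  proof (intro conjI ballI allI)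
    show "g differentiable (at x)" if "x \<in> S" for x
      using D[OF that] differentiable_def by blast
    show "Ck_on k (\<lambda>x. frechet_derivative g (at x) h) S" for h
    proof (rule Suc.IH)
      show "Ck_on k (\<lambda>x. frechet_derivative f (at x) h) S"
        using Suc.prems(1) by simp
    qed (simp add: frechet_derivative_at[OF D, symmetric])
  qed
qed

text \<open>
  The derivative of \<open>L \<circ> f \<circ> (p + A)\<close> in a fixed direction has the same shape, with \<open>f\<close> replaced
  by a directional derivative of \<open>f\<close> and the constant dropped, so the class is stable under the
  recursion that defines \<open>Ck_on\<close>.
\<close>

lemma Ck_on_affine_compose:
  assumes "Ck_on k f S" "open R" "bounded_linear L" "bounded_linear A"
    and "\<And>x. x \<in> R \<Longrightarrow> p + A x \<in> S"
  shows "Ck_on k (\<lambda>x. L (f (p + A x)) + d) R"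
  using assms(1)
proof (induction k arbitrary: f d)
  case 0
  interpret L: bounded_linear L by fact
  interpret A: bounded_linear A by fact
  have "continuous_on R (\<lambda>x. f (p + A x))"
    by (rule continuous_on_compose2[of S f])
      (use 0 assms(5) in \<open>auto intro!: continuous_intros A.continuous_on\<close>)
  then show ?case
    by (auto intro!: continuous_intros L.continuous_on)
next
  case (Suc k)
  interpret L: bounded_linear L by fact
  interpret A: bounded_linear A by fact
  let ?g = "\<lambda>x. L (f (p + A x)) + d"
  have D: "(?g has_derivative (\<lambda>h. L (frechet_derivative f (at (p + A x)) (A h)))) (at x)"
    if "x \<in> R" for x
  proof -
    have "(f has_derivative frechet_derivative f (at (p + A x))) (at (p + A x))"
      using Suc.prems assms(5)[OF that] by (simp flip: frechet_derivative_works)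
    moreover have "((\<lambda>x. p + A x) has_derivative A) (at x)"
      by (auto intro!: derivative_eq_intros A.has_derivative)
    ultimately have "((\<lambda>x. f (p + A x)) has_derivative
        (\<lambda>h. frechet_derivative f (at (p + A x)) (A h))) (at x)"
      using has_derivative_compose by blast
    then show ?thesis
      by (auto intro!: derivative_eq_intros L.has_derivative)
  qed
  show ?case
    unfolding Ck_on.simps
  proof (intro conjI ballI allI)
    show "?g differentiable (at x)" if "x \<in> R" for x
      using D[OF that] differentiable_def by blast
    fix h
    have "Ck_on k (\<lambda>y. frechet_derivative f (at y) (A h)) S"
      using Suc.prems by simp
    from Suc.IH[OF this, of 0]
    have "Ck_on k (\<lambda>x. L (frechet_derivative f (at (p + A x)) (A h)) + 0) R" .
    then show "Ck_on k (\<lambda>x. frechet_derivative ?g (at x) h) R"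
      by (rule Ck_on_cong[OF _ assms(2)]) (simp add: frechet_derivative_at[OF D, symmetric])
  qed
qed

lemma smooth_on_has_derivative:
  assumes "smooth_on f S" "x \<in> S"
  shows "(f has_derivative frechet_derivative f (at x)) (at x)"
proof -
  have "Ck_on (Suc 0) f S" using assms(1) unfolding smooth_on_def by blast
  then show ?thesis using assms(2) by (simp flip: frechet_derivative_works)
qed

lemma bounded_linear_partials:
  fixes D :: "real \<times> real \<Rightarrow> 'b::real_normed_vector"
  assumes "bounded_linear D"
  shows "D h = fst h *\<^sub>R D (1, 0) + snd h *\<^sub>R D (0, 1)"
proof -
  interpret D: bounded_linear D by fact
  have "D h = D (fst h *\<^sub>R (1, 0) + snd h *\<^sub>R (0, 1))" by simp
  then show ?thesis by (simp only: D.add D.scaleR)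
qed

text \<open>
  Chain rules for a function of several variables, whose derivative is a linear functional rather
  than multiplication by a number.
\<close>

lemma has_derivative_sinh_comp [derivative_intros]:
  fixes g :: "'a::real_normed_vector \<Rightarrow> real"
  assumes "(g has_derivative g') (at x within S)"
  shows "((\<lambda>x. sinh (g x)) has_derivative (\<lambda>h. cosh (g x) * g' h)) (at x within S)"
  using has_derivative_compose[OF assms, of sinh "(*) (cosh (g x))"] has_field_derivative_sinh[OF DERIV_ident, of "g x"]
  by (simp add: has_field_derivative_def)

lemma has_derivative_cosh_comp [derivative_intros]:
  fixes g :: "'a::real_normed_vector \<Rightarrow> real"
  assumes "(g has_derivative g') (at x within S)"
  shows "((\<lambda>x. cosh (g x)) has_derivative (\<lambda>h. sinh (g x) * g' h)) (at x within S)"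
  using has_derivative_compose[OF assms, of cosh "(*) (sinh (g x))"] has_field_derivative_cosh[OF DERIV_ident, of "g x"]
  by (simp add: has_field_derivative_def)

section \<open>Equality of mixed partial derivatives\<close>

text \<open>
  The quotient below is symmetric in the two variables, while its limit is the \<open>y\<close>-derivative of
  the \<open>x\<close>-derivative. The mean value theorem in \<open>x\<close>, applied to \<open>f(x, b + h) - f(x, b)\<close>, turns the
  numerator into \<open>h (p(x, b + h) - p(x, b))\<close> for some \<open>x\<close> in \<open>(a, a + h)\<close>. Differentiability of
  \<open>p\<close> at \<open>(a, b)\<close> then suffices: both points lie within distance \<open>2h\<close> of \<open>(a, b)\<close>, and the
  unknown \<open>x\<close> cancels from the linear part.
\<close>

lemma second_difference_tendsto:
  fixes f p :: "real \<Rightarrow> real \<Rightarrow> real"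
  assumes "open S" "(a, b) \<in> S"
    and f: "\<And>x y. (x, y) \<in> S \<Longrightarrow> ((\<lambda>x. f x y) has_real_derivative p x y) (at x)"
    and p: "((\<lambda>z. p (fst z) (snd z)) has_derivative P) (at (a, b))"
  shows "((\<lambda>h. (f (a + h) (b + h) - f a (b + h) - f (a + h) b + f a b) / h\<^sup>2) \<longlongrightarrow> P (0, 1))
           (at_right 0)"
proof (rule tendstoI)
  fix e :: real assume "e > 0"
  \<comment> \<open>The linearization errors at the two points are at most \<open>2 e' h\<close> and \<open>e' h\<close>; their sum has to
    stay strictly below \<open>e h\<close>.\<close>
  define e' where "e' = e / 4"
  have e': "e' > 0" using \<open>e > 0\<close> by (simp add: e'_def)
  obtain r where r: "r > 0" "ball (a, b) r \<subseteq> S"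
    using assms(1,2) openE by blast
  interpret P: bounded_linear P using p by (rule has_derivative_bounded_linear)
  obtain d where d: "d > 0"
    "\<And>x y. norm ((x, y) - (a, b)) < d \<Longrightarrow>
        \<bar>p x y - p a b - P ((x, y) - (a, b))\<bar> \<le> e' * norm ((x, y) - (a, b))"
    using p e' unfolding has_derivative_at_alt by (auto simp: split_paired_all)
  define m where "m = min r d / 2"
  have m: "m > 0" using r d by (simp add: m_def)
  have close: "norm ((x, y) - (a, b)) \<le> 2 * h \<and> (x, y) \<in> S \<and> norm ((x, y) - (a, b)) < d"
    if "a \<le> x" "x \<le> a + h" "b \<le> y" "y \<le> b + h" "h < m" for x y h
  proof -
    have "norm ((x, y) - (a, b)) \<le> norm (x - a) + norm (y - b)"
      using norm_Pair_le[of "x - a" "y - b"] by simp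
    also have "\<dots> \<le> 2 * h" using that by simp
    finally have *: "norm ((x, y) - (a, b)) \<le> 2 * h" .
    have "2 * h < r" "2 * h < d" using that(5) by (auto simp: m_def)
    with * have "dist (x, y) (a, b) < r" "norm ((x, y) - (a, b)) < d"
      by (simp_all add: dist_norm)
    then show ?thesis using * r by (auto simp: dist_commute)
  qed
  have "dist ((f (a + h) (b + h) - f a (b + h) - f (a + h) b + f a b) / h\<^sup>2) (P (0, 1)) < e"
    if h: "0 < h" "h < m" for h
  proof -
    let ?g = "\<lambda>x. f x (b + h) - f x b"
    have "\<exists>x. a < x \<and> x < a + h \<and> ?g (a + h) - ?g a = (a + h - a) * (p x (b + h) - p x b)"
    proof (rule MVT2)
      show "(?g has_real_derivative p x (b + h) - p x b) (at x)" if "a \<le> x" "x \<le> a + h" for x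
        using that h close[of x h "b + h"] close[of x h b] by (intro DERIV_diff f) auto
    qed (use h in simp)
    then obtain x where x: "a < x" "x < a + h" "?g (a + h) - ?g a = h * (p x (b + h) - p x b)"
      by auto
    have c1: "\<bar>p x (b + h) - p a b - P ((x, b + h) - (a, b))\<bar> \<le> e' * (2 * h)"
      using close[of x h "b + h"] x h e'
      by (intro order_trans[OF d(2)] mult_left_mono) auto
    have "norm ((x, b) - (a, b)) \<le> h" using x by (simp add: norm_Pair)
    then have c2: "\<bar>p x b - p a b - P ((x, b) - (a, b))\<bar> \<le> e' * h"
      using close[of x h b] x h e'
      by (intro order_trans[OF d(2)] mult_left_mono) auto
    have "P ((x, b + h) - (a, b)) - P ((x, b) - (a, b)) = P (h *\<^sub>R (0, 1))"
      by (subst P.diff[symmetric]) simp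
    also have "\<dots> = h * P (0, 1)" by (simp only: P.scaleR real_scaleR_def)
    finally have "\<bar>p x (b + h) - p x b - h * P (0, 1)\<bar> \<le> e' * (3 * h)"
      using c1 c2 by (simp add: algebra_simps abs_le_iff)
    also have "\<dots> < e * h" using h \<open>e > 0\<close> by (simp add: e'_def)
    finally have *: "\<bar>p x (b + h) - p x b - h * P (0, 1)\<bar> < e * h" .
    have "(f (a + h) (b + h) - f a (b + h) - f (a + h) b + f a b) / h\<^sup>2 - P (0, 1)
        = (p x (b + h) - p x b - h * P (0, 1)) / h"
    proof -
      have "f (a + h) (b + h) - f a (b + h) - f (a + h) b + f a b = h * (p x (b + h) - p x b)"
        (is "?l = _") using x(3) by simp
      show ?thesis unfolding \<open>?l = _\<close> using h by (simp add: field_simps power2_eq_square)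
    qed
    then show ?thesis
      using * h by (simp only: dist_real_def abs_divide) (simp add: divide_less_eq)
  qed
  then show "\<forall>\<^sub>F h in at_right 0.
      dist ((f (a + h) (b + h) - f a (b + h) - f (a + h) b + f a b) / h\<^sup>2) (P (0, 1)) < e"
    using m unfolding eventually_at_right_field by blast
qed

text \<open>
  Young's theorem: the second difference quotient is symmetric in \<open>x\<close> and \<open>y\<close>, so the two
  iterated derivatives are limits of the same expression.
\<close>

lemma mixed_partials_eq:
  fixes f p q :: "real \<times> real \<Rightarrow> real"
  assumes "open S" "z \<in> S"
    and f: "\<And>w. w \<in> S \<Longrightarrow> (f has_derivative (\<lambda>h. p w * fst h + q w * snd h)) (at w)"
    and p: "(p has_derivative P) (at z)" and q: "(q has_derivative Q) (at z)"
  shows "P (0, 1) = Q (1, 0)"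
proof -
  obtain a b where z: "z = (a, b)" by fastforce
  have fx: "((\<lambda>x. f (x, y)) has_real_derivative p (x, y)) (at x)" if "(x, y) \<in> S" for x y
  proof -
    have "((\<lambda>x. (x, y)) has_derivative (\<lambda>h. (h, 0))) (at x)"
      by (auto intro!: derivative_eq_intros)
    from has_derivative_compose[OF this f[OF that]] show ?thesis
      by (simp add: has_field_derivative_def)
  qed
  have fy: "((\<lambda>y. f (x, y)) has_real_derivative q (x, y)) (at y)" if "(x, y) \<in> S" for x y
  proof -
    have "((\<lambda>y. (x, y)) has_derivative (\<lambda>h. (0, h))) (at y)"
      by (auto intro!: derivative_eq_intros)
    from has_derivative_compose[OF this f[OF that]] show ?thesis
      by (simp add: has_field_derivative_def)
  qed
  have swap: "bounded_linear (prod.swap :: real \<times> real \<Rightarrow> real \<times> real)"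
    unfolding prod.swap_def by (intro bounded_linear_Pair bounded_linear_fst bounded_linear_snd)
  have lim1: "((\<lambda>h. (f (a + h, b + h) - f (a, b + h) - f (a + h, b) + f (a, b)) / h\<^sup>2) \<longlongrightarrow> P (0, 1))
      (at_right 0)"
    by (rule second_difference_tendsto[where f = "\<lambda>x y. f (x, y)" and p = "\<lambda>x y. p (x, y)"])
      (use assms z fx in auto)
  have "open (prod.swap -` S)"
    using \<open>open S\<close> by (intro open_vimage) (auto intro: bounded_linear.continuous_on[OF swap])
  moreover have "((\<lambda>w. q (prod.swap w)) has_derivative (\<lambda>h. Q (prod.swap h))) (at (b, a))"
    using has_derivative_compose[OF bounded_linear_imp_has_derivative[OF swap], of q Q "(b, a)"] q z
    by simp
  ultimately have
    "((\<lambda>h. (f (a + h, b + h) - f (a + h, b) - f (a, b + h) + f (a, b)) / h\<^sup>2)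
        \<longlongrightarrow> Q (prod.swap (0, 1))) (at_right 0)"
    by (intro second_difference_tendsto[where f = "\<lambda>x y. f (y, x)" and p = "\<lambda>x y. q (y, x)"
          and P = "\<lambda>h. Q (prod.swap h)" and S = "prod.swap -` S"])
      (use assms z fy in \<open>auto simp: prod.swap_def\<close>)
  then have lim2: "((\<lambda>h. (f (a + h, b + h) - f (a, b + h) - f (a + h, b) + f (a, b)) / h\<^sup>2)
      \<longlongrightarrow> Q (1, 0)) (at_right 0)"
    by (simp add: algebra_simps)
  show ?thesis
    by (rule tendsto_unique[OF _ lim1 lim2]) simp
qed

section \<open>Helix surfaces in adapted coordinates\<close>

locale helix_coordinates =
  fixes \<tau> \<theta> :: real
    and I J :: "real set"
    and F N :: "real \<times> real \<Rightarrow> real^3"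
    and \<phi> :: "real \<times> real \<Rightarrow> real"
    and \<eta> :: "real \<Rightarrow> real"
  assumes tau: "\<tau> \<noteq> 0"
    and I: "open I" "is_interval I" "I \<noteq> {}"
    and J: "open J" "is_interval J" "J \<noteq> {}"
    and helix: "helix_timelike_surface \<tau> (I \<times> J) F N"
    and angle: "has_hyperbolic_angle \<tau> \<theta> \<phi> (I \<times> J) F N"
    and eta: "smooth_on \<eta> J"
    and F_u: "\<And>u v. u \<in> I \<Longrightarrow> v \<in> J \<Longrightarrow>
           frechet_derivative F (at (u, v)) (1, 0) = tangential_E3 \<tau> 1 F N (u, v)"
    and F_v: "\<And>u v. u \<in> I \<Longrightarrow> v \<in> J \<Longrightarrow>
           frechet_derivative F (at (u, v)) (0, 1) =
             coeff_a \<tau> \<theta> \<eta> u v *\<^sub>R tangential_E3 \<tau> 1 F N (u, v)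
             + coeff_b \<tau> \<theta> \<eta> u v *\<^sub>R J_op \<tau> F N (u, v) (tangential_E3 \<tau> 1 F N (u, v))"
begin

abbreviation s :: real where "s \<equiv> sin \<theta>"
abbreviation c :: real where "c \<equiv> cos \<theta>"

definition rate :: real where "rate = 2 * \<tau> * s\<^sup>2"

text \<open>The common argument of the hyperbolic functions in \<open>coeff_a\<close> and \<open>coeff_b\<close>.\<close>

definition A :: "real \<times> real \<Rightarrow> real" where "A q = rate * fst q + \<eta> (snd q)"

lemma s_nonzero: "s \<noteq> 0"
  using angle by (simp add: has_hyperbolic_angle_def)

lemma open_domain: "open (I \<times> J)"
  using I J by (simp add: open_Times)

lemma F_smooth: "smooth_on F (I \<times> J)" and F_immersion: "q \<in> I \<times> J \<Longrightarrow> inj (frechet_derivative F (at q))"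
  using helix by (auto simp: helix_timelike_surface_def helix_surface_def oriented_surface_def)

lemma phi_smooth: "smooth_on \<phi> (I \<times> J)"
  using angle by (simp add: has_hyperbolic_angle_def)

lemma tangential_E3_components:
  assumes "q \<in> I \<times> J"
  shows "tangential_E3 \<tau> 1 F N q $ 1 = - s * c * cosh (\<phi> q)"
    and "tangential_E3 \<tau> 1 F N q $ 2 = - s * c * sinh (\<phi> q)"
    and "tangential_E3 \<tau> 1 F N q $ 3 =
      c\<^sup>2 - \<tau> * s * c * (F q $ 1 * sinh (\<phi> q) - F q $ 2 * cosh (\<phi> q))"
  using angle assms
  by (auto simp: has_hyperbolic_angle_def tangential_E3_def E1_def E2_def E3_def cos_squared_eq
      algebra_simps power2_eq_square)

text \<open>
  Since \<open>T = E3 - sin \<theta> N\<close> and \<open>N \<and> N = 0\<close>, the vector \<open>JT\<close> is simply \<open>N \<and> E3\<close>.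
\<close>

lemma J_tangential_E3_components:
  assumes "q \<in> I \<times> J"
  shows "J_op \<tau> F N q (tangential_E3 \<tau> 1 F N q) $ 1 = c * sinh (\<phi> q)"
    and "J_op \<tau> F N q (tangential_E3 \<tau> 1 F N q) $ 2 = c * cosh (\<phi> q)"
    and "J_op \<tau> F N q (tangential_E3 \<tau> 1 F N q) $ 3 =
      \<tau> * c * (F q $ 1 * cosh (\<phi> q) - F q $ 2 * sinh (\<phi> q))"
proof -
  define e1 e2 e3 where "e1 = E1 \<tau> (F q)" and "e2 = E2 \<tau> (F q)" and "e3 = E3 (F q)"
  have N: "N q = c *\<^sub>R (cosh (\<phi> q) *\<^sub>R e1 + sinh (\<phi> q) *\<^sub>R e2) + s *\<^sub>R e3"
    using angle assms by (auto simp: has_hyperbolic_angle_def e1_def e2_def e3_def)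
  have T: "tangential_E3 \<tau> 1 F N q = e3 - s *\<^sub>R N q"
    using angle assms by (auto simp: has_hyperbolic_angle_def tangential_E3_def e3_def)
  interpret X: bounded_linear "heis_cross \<tau> (F q) (N q)"
    using bilinear_heis_cross[of \<tau> "F q"] by (simp add: bilinear_def linear_conv_bounded_linear)
  have "heis_cross \<tau> (F q) (N q) (N q) = 0"
    by (simp add: heis_cross_def)
  then have "J_op \<tau> F N q (tangential_E3 \<tau> 1 F N q) = heis_cross \<tau> (F q) (N q) e3"
    by (simp add: J_op_def T X.diff X.scaleR)
  also have "\<dots> = c *\<^sub>R (sinh (\<phi> q) *\<^sub>R e1 + cosh (\<phi> q) *\<^sub>R e2)"
    unfolding N by (simp add: heis_cross_def vec_eq_iff forall_3 contact_form_def
        e1_def e2_def e3_def E1_def E2_def E3_def algebra_simps)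
  finally have JT: "J_op \<tau> F N q (tangential_E3 \<tau> 1 F N q) = \<dots>" .
  show "J_op \<tau> F N q (tangential_E3 \<tau> 1 F N q) $ 1 = c * sinh (\<phi> q)"
    and "J_op \<tau> F N q (tangential_E3 \<tau> 1 F N q) $ 2 = c * cosh (\<phi> q)"
    unfolding JT by (simp_all add: e1_def e2_def E1_def E2_def)
  show "J_op \<tau> F N q (tangential_E3 \<tau> 1 F N q) $ 3 =
      \<tau> * c * (F q $ 1 * cosh (\<phi> q) - F q $ 2 * sinh (\<phi> q))"
    unfolding JT by (simp add: e1_def e2_def E1_def E2_def algebra_simps)
qed

text \<open>If \<open>cos \<theta>\<close> were zero, then \<open>N = \<plusminus>E3\<close> and \<open>\<partial>\<^sub>u F = T = 0\<close>, contrary to \<open>F\<close> being an immersion.\<close>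

lemma c_nonzero: "c \<noteq> 0"
proof
  assume "c = 0"
  obtain u v where uv: "u \<in> I" "v \<in> J" using I J by blast
  then have "tangential_E3 \<tau> 1 F N (u, v) = 0"
    using \<open>c = 0\<close> by (simp add: vec_eq_iff forall_3 tangential_E3_components)
  then have "frechet_derivative F (at (u, v)) (1, 0) = 0"
    using F_u uv by simp
  moreover have "frechet_derivative F (at (u, v)) 0 = 0"
    using smooth_on_has_derivative[OF F_smooth, of "(u, v)"] uv
    by (auto dest!: has_derivative_bounded_linear simp: linear_simps)
  ultimately show False
    using F_immersion[of "(u, v)"] uv by (auto dest!: injD[of _ "(1, 0)" 0] simp: zero_prod_def)
qed

lemma F_component_has_derivative:
  assumes q: "q \<in> I \<times> J"
  shows "((\<lambda>q. F q $ i) has_derivative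
    (\<lambda>h. tangential_E3 \<tau> 1 F N q $ i * fst h +
         (sinh (A q) / s * tangential_E3 \<tau> 1 F N q $ i
          + cosh (A q) * J_op \<tau> F N q (tangential_E3 \<tau> 1 F N q) $ i) * snd h)) (at q)"
proof -
  obtain u v where uv: "q = (u, v)" "u \<in> I" "v \<in> J" using q by blast
  let ?D = "frechet_derivative F (at q)"
  have D: "(F has_derivative ?D) (at q)"
    by (rule smooth_on_has_derivative[OF F_smooth q])
  interpret D: bounded_linear ?D using D by (rule has_derivative_bounded_linear)
  have split: "?D h = fst h *\<^sub>R ?D (1, 0) + snd h *\<^sub>R ?D (0, 1)" for h
    by (rule bounded_linear_partials[OF D.bounded_linear_axioms])
  have "((\<lambda>q. F q $ i) has_derivative (\<lambda>h. ?D h $ i)) (at q)"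
    using bounded_linear.has_derivative[OF bounded_linear_vec_nth D] by simp
  also have "(\<lambda>h. ?D h $ i) = (\<lambda>h. tangential_E3 \<tau> 1 F N q $ i * fst h +
         (sinh (A q) / s * tangential_E3 \<tau> 1 F N q $ i
          + cosh (A q) * J_op \<tau> F N q (tangential_E3 \<tau> 1 F N q) $ i) * snd h)"
    using F_u[OF uv(2,3)] F_v[OF uv(2,3)]
    by (subst split) (simp add: uv(1) coeff_a_def coeff_b_def A_def rate_def mult.commute)
  finally show ?thesis .
qed

lemma x_has_derivative:
  assumes q: "q \<in> I \<times> J"
  shows "((\<lambda>q. F q $ 1) has_derivative
    (\<lambda>h. - s * c * cosh (\<phi> q) * fst h + c * sinh (\<phi> q - A q) * snd h)) (at q)"
  using F_component_has_derivative[OF q, of 1] s_nonzero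
  by (simp add: tangential_E3_components[OF q] J_tangential_E3_components[OF q] sinh_diff
      algebra_simps)

lemma y_has_derivative:
  assumes q: "q \<in> I \<times> J"
  shows "((\<lambda>q. F q $ 2) has_derivative
    (\<lambda>h. - s * c * sinh (\<phi> q) * fst h + c * cosh (\<phi> q - A q) * snd h)) (at q)"
  using F_component_has_derivative[OF q, of 2] s_nonzero
  by (simp add: tangential_E3_components[OF q] J_tangential_E3_components[OF q] cosh_diff
      algebra_simps)

lemma z_has_derivative:
  assumes q: "q \<in> I \<times> J"
  shows "((\<lambda>q. F q $ 3) has_derivative
    (\<lambda>h. (c\<^sup>2 - \<tau> * s * c * (F q $ 1 * sinh (\<phi> q) - F q $ 2 * cosh (\<phi> q))) * fst h
      + (c\<^sup>2 * sinh (A q) / s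
         + \<tau> * c * (F q $ 1 * cosh (\<phi> q - A q) - F q $ 2 * sinh (\<phi> q - A q))) * snd h)) (at q)"
proof -
  have "sinh (A q) / s * (c\<^sup>2 - \<tau> * s * c * (F q $ 1 * sinh (\<phi> q) - F q $ 2 * cosh (\<phi> q)))
        + cosh (A q) * (\<tau> * c * (F q $ 1 * cosh (\<phi> q) - F q $ 2 * sinh (\<phi> q)))
      = c\<^sup>2 * sinh (A q) / s
        + \<tau> * c * (F q $ 1 * cosh (\<phi> q - A q) - F q $ 2 * sinh (\<phi> q - A q))"
    using s_nonzero by (simp add: sinh_diff cosh_diff field_simps)
  then show ?thesis
    using F_component_has_derivative[OF q, of 3]
    by (simp only: tangential_E3_components[OF q] J_tangential_E3_components[OF q])
qed

text \<open>
  The integrability condition. Symmetry of the second derivatives of \<open>x\<close> and \<open>y\<close> is a homogeneous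
  linear system for \<open>\<phi>\<^sub>v\<close> and \<open>\<phi>\<^sub>u - rate\<close>; the derivative of \<open>\<eta>\<close> drops out because only the
  \<open>u\<close>-derivative of \<open>A\<close> enters.
\<close>

lemma phi_has_derivative:
  assumes q: "q \<in> I \<times> J"
  shows "(\<phi> has_derivative (\<lambda>h. rate * fst h)) (at q)"
proof -
  let ?D = "frechet_derivative \<phi> (at q)" and ?E = "frechet_derivative \<eta> (at (snd q))"
  let ?B = "\<phi> q - A q"
  have D: "(\<phi> has_derivative ?D) (at q)"
    by (rule smooth_on_has_derivative[OF phi_smooth q])
  interpret D: bounded_linear ?D using D by (rule has_derivative_bounded_linear)
  have E: "(\<eta> has_derivative ?E) (at (snd q))"
    by (rule smooth_on_has_derivative[OF eta]) (use q in auto)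
  interpret E: bounded_linear ?E using E by (rule has_derivative_bounded_linear)
  have A: "(A has_derivative (\<lambda>h. rate * fst h + ?E (snd h))) (at q)"
    unfolding A_def
    by (auto intro!: derivative_eq_intros
        has_derivative_compose[OF bounded_linear_imp_has_derivative[OF bounded_linear_snd] E])
  have xy: "- s * c * sinh (\<phi> q) * ?D (0, 1) = c * cosh ?B * (?D (1, 0) - rate)"
  proof -
    have "((\<lambda>q. - s * c * cosh (\<phi> q)) has_derivative (\<lambda>h. - s * c * sinh (\<phi> q) * ?D h)) (at q)"
      by (auto intro!: derivative_eq_intros D)
    moreover have "((\<lambda>q. c * sinh (\<phi> q - A q)) has_derivative
        (\<lambda>h. c * cosh ?B * (?D h - (rate * fst h + ?E (snd h))))) (at q)"
      by (auto intro!: derivative_eq_intros D A)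
    ultimately show ?thesis
      using mixed_partials_eq[OF open_domain q x_has_derivative] E.zero by fastforce
  qed
  have yx: "- s * c * cosh (\<phi> q) * ?D (0, 1) = c * sinh ?B * (?D (1, 0) - rate)"
  proof -
    have "((\<lambda>q. - s * c * sinh (\<phi> q)) has_derivative (\<lambda>h. - s * c * cosh (\<phi> q) * ?D h)) (at q)"
      by (auto intro!: derivative_eq_intros D)
    moreover have "((\<lambda>q. c * cosh (\<phi> q - A q)) has_derivative
        (\<lambda>h. c * sinh ?B * (?D h - (rate * fst h + ?E (snd h))))) (at q)"
      by (auto intro!: derivative_eq_intros D A)
    ultimately show ?thesis
      using mixed_partials_eq[OF open_domain q y_has_derivative] E.zero by fastforce
  qed
  \<comment> \<open>Eliminate \<open>\<phi>\<^sub>u - rate\<close> from the two equations; the coefficient of \<open>\<phi>\<^sub>v\<close> that remains is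
    \<open>s c cosh A\<close>.\<close>
  have "s * c * ?D (0, 1) * cosh (\<phi> q - ?B)
      = sinh ?B * (- s * c * sinh (\<phi> q) * ?D (0, 1)) - cosh ?B * (- s * c * cosh (\<phi> q) * ?D (0, 1))"
    by (subst cosh_diff) (simp add: algebra_simps)
  also have "\<dots> = 0"
    unfolding xy yx by simp
  finally have v: "?D (0, 1) = 0"
    using s_nonzero c_nonzero by simp
  with xy have u: "?D (1, 0) = rate"
    using c_nonzero by simp
  have "?D h = fst h *\<^sub>R ?D (1, 0) + snd h *\<^sub>R ?D (0, 1)" for h
    by (rule bounded_linear_partials[OF D.bounded_linear_axioms])
  then have "?D = (\<lambda>h. rate * fst h)"
    unfolding u v by (simp add: fun_eq_iff)
  then show ?thesis using D by simp
qed

lemma phi_affine: "\<exists>k. \<forall>q\<in>I \<times> J. \<phi> q = rate * fst q + k"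
proof -
  have "convex (I \<times> J)"
    using I J by (simp add: convex_Times is_interval_convex)
  moreover have "((\<lambda>q. \<phi> q - rate * fst q) has_derivative (\<lambda>h. 0)) (at q within I \<times> J)"
    if "q \<in> I \<times> J" for q
    by (rule has_derivative_at_withinI)
      (auto intro!: derivative_eq_intros phi_has_derivative that)
  ultimately obtain k where "\<forall>q\<in>I \<times> J. \<phi> q - rate * fst q = k"
    using has_derivative_zero_constant by blast
  then show ?thesis by (intro exI[of _ k]) (auto simp: algebra_simps)
qed

lemma depends_on_v_only:
  assumes f: "\<And>q. q \<in> I \<times> J \<Longrightarrow> (f has_derivative (\<lambda>h. d q * snd h)) (at q)"
    and "u \<in> I" "u' \<in> I" "v \<in> J"
  shows "f (u, v) = (f (u', v) :: real)"
proof (rule has_derivative_zero_unique[where f = "\<lambda>u. f (u, v)" and s = I])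
  show "((\<lambda>u. f (u, v)) has_derivative (\<lambda>h. 0)) (at u within I)" if "u \<in> I" for u
  proof -
    have "((\<lambda>u. (u, v)) has_derivative (\<lambda>h. (h, 0))) (at u)"
      by (auto intro!: derivative_eq_intros)
    from has_derivative_compose[OF this f] show ?thesis
      using that \<open>v \<in> J\<close> by (auto intro: has_derivative_at_withinI)
  qed
qed (use assms I in \<open>auto simp: is_interval_convex\<close>)

lemma DERIV_along_v:
  assumes f: "\<And>q. q \<in> I \<times> J \<Longrightarrow> (f has_derivative (\<lambda>h. d q * snd h)) (at q)"
    and "u \<in> I" "v \<in> J"
  shows "((\<lambda>v. f (u, v)) has_real_derivative d (u, v)) (at v)"
proof -
  have "((\<lambda>v. (u, v)) has_derivative (\<lambda>h. (0, h))) (at v)"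
    by (auto intro!: derivative_eq_intros)
  from has_derivative_compose[OF this f] show ?thesis
    using assms(2,3) by (simp add: has_field_derivative_def)
qed

text \<open>
  The position formula solved for \<open>f1\<close>, \<open>f2\<close> and \<open>f3\<close>, as functions on the whole coordinate
  domain.
\<close>

definition X :: "real \<times> real \<Rightarrow> real" where
  "X q = F q $ 1 + cot \<theta> / (2 * \<tau>) * sinh (\<phi> q)"

definition Y :: "real \<times> real \<Rightarrow> real" where
  "Y q = F q $ 2 + cot \<theta> / (2 * \<tau>) * cosh (\<phi> q)"

definition Z :: "real \<times> real \<Rightarrow> real" where
  "Z q = F q $ 3 - c\<^sup>2 / 2 * (\<phi> q / rate)
     + cot \<theta> / 2 * (X q * cosh (\<phi> q) - Y q * sinh (\<phi> q))"

lemma X_has_derivative: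
  assumes q: "q \<in> I \<times> J"
  shows "(X has_derivative (\<lambda>h. c * sinh (\<phi> q - A q) * snd h)) (at q)"
  unfolding X_def using tau s_nonzero
  by (auto intro!: derivative_eq_intros x_has_derivative phi_has_derivative q
      simp: rate_def cot_def power2_eq_square)

lemma Y_has_derivative:
  assumes q: "q \<in> I \<times> J"
  shows "(Y has_derivative (\<lambda>h. c * cosh (\<phi> q - A q) * snd h)) (at q)"
  unfolding Y_def using tau s_nonzero
  by (auto intro!: derivative_eq_intros y_has_derivative phi_has_derivative q
      simp: rate_def cot_def power2_eq_square)

text \<open>
  Write \<open>m = cot \<theta> / 2\<close>, so that \<open>X = x + (m/\<tau>) sinh \<phi>\<close>, \<open>Y = y + (m/\<tau>) cosh \<phi>\<close> and \<open>c = 2sm\<close>.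
  In the direction of \<open>u\<close> the terms linear in \<open>x\<close> and \<open>y\<close> cancel, and what is left is a multiple
  of \<open>1 + sinh\<^sup>2 \<phi> - cosh\<^sup>2 \<phi> = 0\<close>. In the direction of \<open>v\<close> the term \<open>c\<^sup>2 sinh A / s = 2mc sinh A\<close>
  of \<open>z\<^sub>v\<close> splits into two equal halves: one cancels the derivative of the last summand of \<open>Z\<close>, and
  the other changes \<open>x Y\<^sub>v - y X\<^sub>v\<close> into \<open>X Y\<^sub>v - Y X\<^sub>v\<close>.
\<close>

lemma Z_has_derivative:
  assumes q: "q \<in> I \<times> J"
  shows "(Z has_derivative
    (\<lambda>h. \<tau> * (X q * (c * cosh (\<phi> q - A q)) - Y q * (c * sinh (\<phi> q - A q))) * snd h)) (at q)"
proof -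
  let ?x = "F q $ 1" and ?y = "F q $ 2" and ?C = "cosh (\<phi> q)" and ?S = "sinh (\<phi> q)"
  let ?d1 = "c * sinh (\<phi> q - A q)" and ?d2 = "c * cosh (\<phi> q - A q)"
  define m where "m = c / (2 * s)"
  have cm: "c = 2 * s * m" using s_nonzero by (simp add: m_def)
  have cot: "cot \<theta> = 2 * m" by (simp add: m_def cot_def)
  have hyp: "?C * ?C = 1 + ?S * ?S" using cosh_square_eq[of "\<phi> q"] by (simp add: power2_eq_square)
  have X: "X q = ?x + m / \<tau> * ?S" and Y: "Y q = ?y + m / \<tau> * ?C"
    by (simp_all add: X_def Y_def cot)
  have u0: "c\<^sup>2 - \<tau> * s * c * (?x * ?S - ?y * ?C) - c\<^sup>2 / 2 + m * (X q * ?S - Y q * ?C) * rate = 0"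
  proof -
    have "c\<^sup>2 - \<tau> * s * c * (?x * ?S - ?y * ?C) - c\<^sup>2 / 2 + m * (X q * ?S - Y q * ?C) * rate
      = 2 * s\<^sup>2 * m\<^sup>2 * (1 + ?S * ?S - ?C * ?C)"
      unfolding X Y rate_def cm using tau by (simp add: field_simps power2_eq_square)
    then show ?thesis using hyp by simp
  qed
  have sinhA: "sinh (A q) = ?S * cosh (\<phi> q - A q) - ?C * sinh (\<phi> q - A q)"
    using sinh_diff[of "\<phi> q" "\<phi> q - A q"] by simp
  have v0: "c\<^sup>2 * sinh (A q) / s + \<tau> * c * (?x * cosh (\<phi> q - A q) - ?y * sinh (\<phi> q - A q))
      + m * (?d1 * ?C - ?d2 * ?S) = \<tau> * (X q * ?d2 - Y q * ?d1)"
    unfolding X Y sinhA cm using tau s_nonzero by (simp add: field_simps power2_eq_square)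
  have "(Z has_derivative (\<lambda>h.
      (c\<^sup>2 - \<tau> * s * c * (?x * ?S - ?y * ?C) - c\<^sup>2 / 2 + m * (X q * ?S - Y q * ?C) * rate) * fst h
      + (c\<^sup>2 * sinh (A q) / s + \<tau> * c * (?x * cosh (\<phi> q - A q) - ?y * sinh (\<phi> q - A q))
         + m * (?d1 * ?C - ?d2 * ?S)) * snd h)) (at q)"
    unfolding Z_def cot using tau s_nonzero
    by (auto intro!: derivative_eq_intros z_has_derivative X_has_derivative Y_has_derivative
        phi_has_derivative q simp: rate_def fun_eq_iff algebra_simps)
  then show ?thesis unfolding u0 v0 by simp
qed

text \<open>
  It is essential that \<open>L\<close> and \<open>d\<close> do not depend on \<open>v\<close>: along a line \<open>u = u0\<close> the hyperbolic
  functions of \<open>\<phi>\<close> in \<open>X\<close>, \<open>Y\<close>, \<open>Z\<close> are constants.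
\<close>

lemma smooth_on_slice:
  assumes "u \<in> I" "bounded_linear L"
    and "\<And>v. v \<in> J \<Longrightarrow> g v = L (F (u, v)) + (d::real)"
  shows "smooth_on g J"
  unfolding smooth_on_def
proof
  fix k
  have "Ck_on k (\<lambda>v. L (F ((u, 0) + (0, v))) + d) J"
  proof (rule Ck_on_affine_compose[where L = L and f = F and A = "\<lambda>v. (0, v)" and p = "(u, 0)"
        and S = "I \<times> J"])
    show "Ck_on k F (I \<times> J)" using F_smooth by (simp add: smooth_on_def)
    show "bounded_linear (\<lambda>v::real. (0::real, v))"
      by (intro bounded_linear_Pair bounded_linear_zero bounded_linear_ident)
    show "(u, 0) + (0, v) \<in> I \<times> J" if "v \<in> J" for v
      using that assms(1) by simp
  qed (fact J(1) assms(2))+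
  then show "Ck_on k g J"
    by (rule Ck_on_cong[OF _ J(1)]) (simp add: assms)
qed

lemma helix_position_exists:
  "\<exists>(k::real) f1 f2 f3.
     smooth_on f1 J \<and> smooth_on f2 J \<and> smooth_on f3 J \<and>
     (\<forall>v\<in>J. (deriv f1 v)\<^sup>2 - (deriv f2 v)\<^sup>2 = - (cos \<theta>)\<^sup>2 \<and>
            deriv f3 v = \<tau> * (f1 v * deriv f2 v - f2 v * deriv f1 v)) \<and>
     (\<forall>u\<in>I. \<forall>v\<in>J. \<phi> (u, v) = 2 * \<tau> * (sin \<theta>)\<^sup>2 * u + k \<and>
                   F (u, v) = helix_position \<tau> \<theta> f1 f2 f3 (\<phi> (u, v)) v)"
proof -
  obtain u0 where u0: "u0 \<in> I" using I by blast
  obtain k where k: "\<And>u v. u \<in> I \<Longrightarrow> v \<in> J \<Longrightarrow> \<phi> (u, v) = rate * u + k"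
    using phi_affine by auto
  define w where "w = rate * u0 + k"
  define m where "m = cot \<theta> / (2 * \<tau>)"
  define f1 f2 f3 where "f1 v = X (u0, v)" and "f2 v = Y (u0, v)" and "f3 v = Z (u0, v)" for v
  have X: "X (u, v) = f1 v" and Y: "Y (u, v) = f2 v" and Z: "Z (u, v) = f3 v"
    if "u \<in> I" "v \<in> J" for u v
    unfolding f1_def f2_def f3_def using that u0
    by (auto intro: depends_on_v_only X_has_derivative Y_has_derivative Z_has_derivative)
  have d1: "deriv f1 v = c * sinh (\<phi> (u0, v) - A (u0, v))"
    and d2: "deriv f2 v = c * cosh (\<phi> (u0, v) - A (u0, v))"
    and d3: "deriv f3 v = \<tau> * (f1 v * deriv f2 v - f2 v * deriv f1 v)"
    if "v \<in> J" for v
  proof -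
    show d1: "deriv f1 v = c * sinh (\<phi> (u0, v) - A (u0, v))"
      unfolding f1_def by (intro DERIV_imp_deriv DERIV_along_v X_has_derivative u0 that)
    show d2: "deriv f2 v = c * cosh (\<phi> (u0, v) - A (u0, v))"
      unfolding f2_def by (intro DERIV_imp_deriv DERIV_along_v Y_has_derivative u0 that)
    have "deriv f3 v = \<tau> * (X (u0, v) * (c * cosh (\<phi> (u0, v) - A (u0, v)))
        - Y (u0, v) * (c * sinh (\<phi> (u0, v) - A (u0, v))))"
      unfolding f3_def by (intro DERIV_imp_deriv DERIV_along_v Z_has_derivative u0 that)
    then show "deriv f3 v = \<tau> * (f1 v * deriv f2 v - f2 v * deriv f1 v)"
      by (simp add: d1 d2 f1_def f2_def)
  qed
  have w: "\<phi> (u0, v) = w" if "v \<in> J" for v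
    using k u0 that by (simp add: w_def)
  have s1: "smooth_on f1 J"
  proof (rule smooth_on_slice[OF u0])
    show "f1 v = F (u0, v) $ 1 + m * sinh w" if "v \<in> J" for v
      using w[OF that] by (simp add: f1_def X_def m_def)
  qed (rule bounded_linear_vec_nth)
  have s2: "smooth_on f2 J"
  proof (rule smooth_on_slice[OF u0])
    show "f2 v = F (u0, v) $ 2 + m * cosh w" if "v \<in> J" for v
      using w[OF that] by (simp add: f2_def Y_def m_def)
  qed (rule bounded_linear_vec_nth)
  have s3: "smooth_on f3 J"
  proof (rule smooth_on_slice[OF u0])
    show "bounded_linear (\<lambda>p::real^3. p $ 3 + cot \<theta> / 2 * (p $ 1 * cosh w - p $ 2 * sinh w))"
      by (intro bounded_linear_add bounded_linear_sub bounded_linear_const_mult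
          bounded_linear_mult_const bounded_linear_vec_nth)
    show "f3 v = F (u0, v) $ 3 + cot \<theta> / 2 * (F (u0, v) $ 1 * cosh w - F (u0, v) $ 2 * sinh w)
        + - (c\<^sup>2 / 2 * (w / rate))" if "v \<in> J" for v
      using w[OF that] by (simp add: f3_def Z_def X_def Y_def algebra_simps)
  qed
  have "(deriv f1 v)\<^sup>2 - (deriv f2 v)\<^sup>2 = - c\<^sup>2" if "v \<in> J" for v
    using that by (simp add: d1 d2 power_mult_distrib cosh_square_eq algebra_simps)
  moreover have "F (u, v) = helix_position \<tau> \<theta> f1 f2 f3 (\<phi> (u, v)) v" if "u \<in> I" "v \<in> J" for u v
    using X[OF that] Y[OF that] Z[OF that]
    by (simp add: vec_eq_iff forall_3 helix_position_def X_def Y_def Z_def rate_def algebra_simps)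
  ultimately show ?thesis
    using s1 s2 s3 d3 k
    by (intro exI[of _ k] exI[of _ f1] exI[of _ f2] exI[of _ f3]) (auto simp: rate_def)
qed

end

theorem theorem5p4:
  fixes \<tau> \<theta> :: real
    and I J :: "real set"
    and F N :: "real \<times> real \<Rightarrow> real^3"
    and \<phi> :: "real \<times> real \<Rightarrow> real"
    and \<eta> :: "real \<Rightarrow> real"
  assumes "\<tau> \<noteq> 0"
    and "open I" "is_interval I" "I \<noteq> {}"
    and "open J" "is_interval J" "J \<noteq> {}"
    and "helix_timelike_surface \<tau> (I \<times> J) F N"
    and "has_hyperbolic_angle \<tau> \<theta> \<phi> (I \<times> J) F N"
    and "smooth_on \<eta> J"
    and "\<And>u v. u \<in> I \<Longrightarrow> v \<in> J \<Longrightarrow>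
           frechet_derivative F (at (u, v)) (1, 0) = tangential_E3 \<tau> 1 F N (u, v)"
    and "\<And>u v. u \<in> I \<Longrightarrow> v \<in> J \<Longrightarrow>
           frechet_derivative F (at (u, v)) (0, 1) =
             coeff_a \<tau> \<theta> \<eta> u v *\<^sub>R tangential_E3 \<tau> 1 F N (u, v)
             + coeff_b \<tau> \<theta> \<eta> u v *\<^sub>R J_op \<tau> F N (u, v) (tangential_E3 \<tau> 1 F N (u, v))"
  shows "\<exists>(c::real) f1 f2 f3.
           smooth_on f1 J \<and> smooth_on f2 J \<and> smooth_on f3 J \<and>
           (\<forall>v\<in>J. (deriv f1 v)\<^sup>2 - (deriv f2 v)\<^sup>2 = - (cos \<theta>)\<^sup>2 \<and>
                  deriv f3 v = \<tau> * (f1 v * deriv f2 v - f2 v * deriv f1 v)) \<and>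
           (\<forall>u\<in>I. \<forall>v\<in>J. \<phi> (u, v) = 2 * \<tau> * (sin \<theta>)\<^sup>2 * u + c \<and>
                         F (u, v) = helix_position \<tau> \<theta> f1 f2 f3 (\<phi> (u, v)) v)"
proof -
  interpret helix_coordinates \<tau> \<theta> I J F N \<phi> \<eta>
    by unfold_locales (use assms in auto)
  show ?thesis by (rule helix_position_exists)
qed

end
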